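(* Let $d\in[0,1/6)$. Let (P4) be the problem of maximizing $$\widehat{W}_4(e_0,f)=e_0^2\left(\frac{\frac1{1-d}-\frac1{e_0}}{e_0-2d}+\frac{e_0-2d}{e_0+f-1-4d}\left(\frac{\frac1{1-d}-\frac1f}{f-2d}+\frac{\frac1{1-d}-\frac1{e_0}}{e_0-2d}\right)\right)$$ subject to $e_0,f\in[1-d,1]$, and let (P5) be the problem of maximizing $$\widehat{W}_5(f)=\frac{\frac1{1-d}-1}{1-2d}+\frac{1-2d}{f-4d}\left(\frac{\frac1{1-d}-\frac1f}{f-2d}+\frac{\frac1{1-d}-1}{1-2d}\right)$$ subject to $f\in[1-d,1]$. Then the optimal values of (P4) and (P5) are equal. *)

theory Defs
  imports "HOL-Analysis.Analysis"
begin

text \<open>The optimal value of a maximization problem is taken in the extended reals, so that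
  it is meaningful (never an unspecified real supremum) without a prior boundedness proof.\<close>

definition optimal_value :: "('a \<Rightarrow> real) \<Rightarrow> 'a set \<Rightarrow> ereal" where
  "optimal_value W F = (SUP x\<in>F. ereal (W x))"

definition W4_hat :: "real \<Rightarrow> real \<Rightarrow> real \<Rightarrow> real" where
  "W4_hat d e\<^sub>0 f =
     e\<^sub>0\<^sup>2 * ((1 / (1 - d) - 1 / e\<^sub>0) / (e\<^sub>0 - 2 * d)
       + (e\<^sub>0 - 2 * d) / (e\<^sub>0 + f - 1 - 4 * d)
         * ((1 / (1 - d) - 1 / f) / (f - 2 * d)
            + (1 / (1 - d) - 1 / e\<^sub>0) / (e\<^sub>0 - 2 * d)))"

definition W5_hat :: "real \<Rightarrow> real \<Rightarrow> real" where
  "W5_hat d f =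
     (1 / (1 - d) - 1) / (1 - 2 * d)
       + (1 - 2 * d) / (f - 4 * d)
         * ((1 / (1 - d) - 1 / f) / (f - 2 * d)
            + (1 / (1 - d) - 1) / (1 - 2 * d))"

end

theory Submission
  imports Defs
begin

text \<open>Since \<open>W5_hat d f = W4_hat d 1 f\<close>, it suffices that \<open>W4_hat d e f\<close> is nondecreasing in
  \<open>e\<close> on \<open>[1 - d, 1]\<close>. With \<open>K = (f - 1 + d) / (f (f - 2 d))\<close> one has
  \<open>(1 - d) W4_hat d e f = e (e - 1 + d) / (e - 2 d) + e N(e) / (e + f - 1 - 4 d)\<close>, where
  \<open>N(e) = e - 1 + d + K e (e - 2 d)\<close>. Both summands increase with \<open>e\<close>; the decisive estimate
  is \<open>N(1 - d) \<le> f - 1 + d \<le> f - 5 d\<close>, the last term being the denominator at \<open>e = 1 - d\<close>.\<close>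

lemma W4_hat_decomp:
  fixes d e f :: real
  assumes "d < 1" "0 < e" "2 * d < e" "0 < f" "2 * d < f" "0 < e + f - 1 - 4 * d"
  shows "(1 - d) * W4_hat d e f =
    e * (e - 1 + d) / (e - 2 * d) +
    e * ((e - 1 + d + (f - 1 + d) / (f * (f - 2 * d)) * (e * (e - 2 * d))) / (e + f - 1 - 4 * d))"
proof -
  define D where "D = e + f - 1 - 4 * d"
  define u where "u = e - 2 * d"
  define a where "a = (f - 1 + d) / (f * (f - 2 * d))"
  have pos: "0 < D" "0 < u" "0 < 1 - d" "0 < e" "0 < f" "0 < f - 2 * d"
    using assms by (auto simp: D_def u_def)
  have e_part: "1 / (1 - d) - 1 / e = (e - 1 + d) / ((1 - d) * e)"
    using pos by (simp add: field_simps)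
  have f_part: "(1 / (1 - d) - 1 / f) / (f - 2 * d) = a / (1 - d)"
    using pos by (simp add: field_simps a_def)
  show ?thesis
    unfolding W4_hat_def D_def[symmetric] u_def[symmetric] a_def[symmetric] e_part f_part
    using pos by (simp add: divide_simps) (simp add: algebra_simps power2_eq_square)
qed

text \<open>Polynomial division leaves a linear term minus a constant over \<open>t - 2 * d\<close>.
  The constant \<open>2 * d * (1 - 3 * d)\<close> is nonnegative, so both parts increase with
  \<open>t\<close>.\<close>

lemma mono_first_summand:
  fixes d e e' :: real
  assumes "0 \<le> d" "3 * d \<le> 1" "2 * d < e" "e \<le> e'"
  shows "e * (e - 1 + d) / (e - 2 * d) \<le> e' * (e' - 1 + d) / (e' - 2 * d)"
proof -
  have eq: "t * (t - 1 + d) / (t - 2 * d) = t - 1 + 3 * d - 2 * d * (1 - 3 * d) / (t - 2 * d)"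
    if "2 * d < t" for t
    using that by (simp add: divide_simps) (simp add: algebra_simps)
  have "2 * d * (1 - 3 * d) / (e' - 2 * d) \<le> 2 * d * (1 - 3 * d) / (e - 2 * d)"
    using assms by (intro divide_left_mono mult_pos_pos mult_nonneg_nonneg) auto
  then show ?thesis
    using assms eq[of e] eq[of e'] by simp
qed

text \<open>After cross-multiplication the difference has the factor \<open>x' - x\<close>. In the
  cofactor only \<open>c - K * A\<close> could be negative, which \<open>K * A \<le> c\<close>
  excludes.\<close>

lemma mono_quadratic_quotient:
  fixes x x' c K A B :: real
  assumes "0 \<le> x" "x \<le> x'" "0 < c" "0 \<le> K" "0 \<le> B" "K * A \<le> c"
  shows "(x + K * (A + B * x + x\<^sup>2)) / (x + c) \<le> (x' + K * (A + B * x' + x'\<^sup>2)) / (x' + c)"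
proof -
  have "0 \<le> (x' - x) * ((c - K * A) + K * B * c + K * (x * x' + c * (x + x')))"
    using assms by (intro mult_nonneg_nonneg add_nonneg_nonneg) auto
  also have "\<dots> = (x' + K * (A + B * x' + x'\<^sup>2)) * (x + c) - (x + K * (A + B * x + x\<^sup>2)) * (x' + c)"
    by (simp add: algebra_simps power2_eq_square)
  finally show ?thesis
    using assms by (simp add: divide_simps)
qed

lemma W4_hat_mono:
  fixes d e e' f :: real
  assumes d: "0 \<le> d" "d < 1/6" and e: "1 - d \<le> e" "e \<le> e'" and f: "1 - d \<le> f"
  shows "W4_hat d e f \<le> W4_hat d e' f"
proof -
  define K where "K = (f - 1 + d) / (f * (f - 2 * d))"
  \<comment> \<open>\<open>A\<close> is the value of \<open>t * (t - 2 * d)\<close> at the left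
    endpoint \<open>t = 1 - d\<close>.\<close>
  define A where "A = (1 - d) * (1 - 3 * d)"
  define G where "G t = (t - 1 + d + K * (t * (t - 2 * d))) / (t + f - 1 - 4 * d)" for t
  have K: "0 \<le> K"
    unfolding K_def using d f by (intro divide_nonneg_nonneg mult_nonneg_nonneg) auto
  have A: "0 < A" "A \<le> f * (f - 2 * d)"
    unfolding A_def using d f by (auto intro!: mult_mono mult_pos_pos)
  have "K * A \<le> K * (f * (f - 2 * d))"
    using K A by (intro mult_left_mono)
  also have "\<dots> = f - 1 + d"
    using d f by (simp add: K_def)
  \<comment> \<open>This is \<open>6 * d \<le> 1\<close>, the source of the bound 1/6.\<close>
  also have "\<dots> \<le> f - 5 * d"
    using d by simp
  finally have KA: "K * A \<le> f - 5 * d" .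
  \<comment> \<open>Expansion about the left endpoint: with \<open>x = t - 1 + d\<close>,
    \<open>t * (t - 2 * d)\<close> factors as \<open>(x + 1 - d) * (x + 1 - 3 * d)\<close>.\<close>
  have "G t = (t - 1 + d + K * (A + (2 - 4 * d) * (t - 1 + d) + (t - 1 + d)\<^sup>2)) /
      (t - 1 + d + (f - 5 * d))" for t
    unfolding G_def A_def by (rule arg_cong2[of _ _ _ _ "(/)"]) (algebra, simp)
  then have "G e \<le> G e'"
    using mono_quadratic_quotient[of "e - 1 + d" "e' - 1 + d" "f - 5 * d" K "2 - 4 * d" A]
      d e f K KA by simp
  \<comment> \<open>Monotonicity of the product \<open>t * G t\<close> needs the sign of
    \<open>G e\<close> as well as the growth of \<open>G\<close>.\<close>
  moreover have "0 \<le> K * (e * (e - 2 * d))"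
    using d e K by (intro mult_nonneg_nonneg) auto
  then have "0 \<le> G e"
    unfolding G_def using d e f by (intro divide_nonneg_nonneg) auto
  ultimately have "e * G e \<le> e' * G e'"
    using d e by (intro mult_mono) auto
  moreover have "e * (e - 1 + d) / (e - 2 * d) \<le> e' * (e' - 1 + d) / (e' - 2 * d)"
    using d e by (intro mono_first_summand) auto
  moreover have "(1 - d) * W4_hat d t f = t * (t - 1 + d) / (t - 2 * d) + t * G t"
    if "1 - d \<le> t" for t
    unfolding G_def K_def using d f that by (intro W4_hat_decomp) auto
  ultimately have "(1 - d) * W4_hat d e f \<le> (1 - d) * W4_hat d e' f"
    using e by simp
  then show ?thesis
    using d by simp
qed

lemma W4_hat_one: "W4_hat d 1 f = W5_hat d f"
  by (simp add: W4_hat_def W5_hat_def)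

theorem theorem4p10:
  fixes d :: real
  assumes "d \<in> {0..<1/6}"
  shows "optimal_value (\<lambda>(e\<^sub>0, f). W4_hat d e\<^sub>0 f) ({1 - d..1} \<times> {1 - d..1})
       = optimal_value (W5_hat d) {1 - d..1}"
  unfolding optimal_value_def
proof (rule antisym)
  show "(SUP x\<in>{1 - d..1} \<times> {1 - d..1}. ereal (case x of (e\<^sub>0, f) \<Rightarrow> W4_hat d e\<^sub>0 f))
      \<le> (SUP f\<in>{1 - d..1}. ereal (W5_hat d f))"
  proof (rule SUP_least, clarify)
    fix e f :: real
    assume ef: "e \<in> {1 - d..1}" "f \<in> {1 - d..1}"
    have "W4_hat d e f \<le> W5_hat d f"
      using W4_hat_mono[of d e 1 f] ef assms by (simp add: W4_hat_one)
    then show "ereal (W4_hat d e f) \<le> (SUP f\<in>{1 - d..1}. ereal (W5_hat d f))"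
      using ef by (intro SUP_upper2[of f]) auto
  qed
  show "(SUP f\<in>{1 - d..1}. ereal (W5_hat d f))
      \<le> (SUP x\<in>{1 - d..1} \<times> {1 - d..1}. ereal (case x of (e\<^sub>0, f) \<Rightarrow> W4_hat d e\<^sub>0 f))"
  proof (rule SUP_least)
    fix f assume "f \<in> {1 - d..1}"
    then show "ereal (W5_hat d f)
        \<le> (SUP x\<in>{1 - d..1} \<times> {1 - d..1}. ereal (case x of (e\<^sub>0, f) \<Rightarrow> W4_hat d e\<^sub>0 f))"
      \<comment> \<open>The point \<open>(1, f)\<close> is feasible because
        \<open>0 \<le> d\<close>.\<close>
      using assms by (intro SUP_upper2[of "(1, f)"]) (auto simp: W4_hat_one)
  qed
qed

end
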